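(* Let $X$ and $X'$ be bounded geometry (connected) Riemannian manifolds or polyhedra. Assume that $X$ and $X'$ have isoperimetric dimension $>1$. Then every homeomorphism $f:X\to X'$ such that both $f$ and $f^{-1}$ are large scale conformal is a quasi-isometry.
   Context: Bounded geometry: for a Riemannian manifold, complete with bounded sectional curvature and injectivity radius bounded below; for a polyhedron (simplicial complex with the length metric for which simplices are standard Euclidean), a uniform bound on the number of simplices containing a given vertex. Isoperimetric dimension: a Riemannian manifold $X$ has isoperimetric dimension $\ge d$ if there is a constant $C$ such that compact subsets $D\subset X$ with smooth boundary and sufficiently large volume satisfy $\mathrm{volume}(D)\le C\,\mathrm{volume}(\partial D)^{\frac{d}{d-1}}$. For a polyhedron, use the analogous inequality for finite sets $D$ of vertices, with $\mathrm{volume}(D)$ the number of vertices of $D$ and $\mathrm{volume}(\partial D)$ the number of edges of the 1-skeleton joining $D$ to its complement. Isoperimetric dimension $>1$ means isoperimetric dimension $\ge d$ for some $d>1$. Balls and packings: in a metric space $X$, a ball is a pair $B=(x,r)$ with $x\in X$, $0\le r<\infty$, identified with $B(x,r)=\{y: d(x,y)\le r\}$; $\lambda B=B(x,\lambda r)$. For $0\le R\le S\le\infty$, $\mathcal{B}^X_{R,S}$ is the set of balls whose radius $r$ satisfies $R\le r\le S$. An $(\ell,R,S)$-packing is an (indexed) family $\{B_j\}$ of balls with radii between $R$ and $S$ such that the concentric balls $\ell B_j$ are pairwise disjoint. An $(N,\ell,R,S)$-packing is a union of at most $N$ $(\ell,R,S)$-packings. A map $f:X\to X'$ between metric spaces is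 $(R,S,R',S')$-coarsely conformal if there exists a map $B\mapsto B'$, $\mathcal{B}^X_{R,S}\to\mathcal{B}^{X'}_{R',S'}$, and, for all $\ell'\ge1$, an $\ell\ge1$ and an $N'$ such that (1) $f(B)\subset B'$ for all $B\in\mathcal{B}^X_{R,S}$; (2) if $\{B_j\}$ is an $(\ell,R,S)$-packing of $X$, then $\{B'_j\}$ is an $(N',\ell',R',S')$-packing of $X'$. $f$ is large scale conformal if for every $R'>0$ there exists $R>0$ such that $f$ is $(R,\infty,R',\infty)$-coarsely conformal. *)

theory Defs
  imports "HOL-Analysis.Analysis"
begin

section \<open>Smooth manifolds modelled on metric spaces\<close>

text \<open>
  The underlying topological space of every manifold and polyhedron is a type of class
  \<open>metric_space\<close>, and \<^const>\<open>dist\<close> is required to be the Riemannian distance, respectively the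
  length metric. Connected metric spaces with an atlas are Hausdorff and second countable.
\<close>

primrec Ck_on :: "nat \<Rightarrow> 'a::real_normed_vector set \<Rightarrow> ('a \<Rightarrow> 'b::real_normed_vector) \<Rightarrow> bool" where
  "Ck_on 0 U f \<longleftrightarrow> continuous_on U f"
| "Ck_on (Suc k) U f \<longleftrightarrow> (\<forall>x\<in>U. f differentiable (at x)) \<and>
     (\<forall>v. Ck_on k U (\<lambda>x. frechet_derivative f (at x) v))"

text \<open>Intended for open \<open>U\<close> only.\<close>

definition smooth_on :: "'a::real_normed_vector set \<Rightarrow> ('a \<Rightarrow> 'b::real_normed_vector) \<Rightarrow> bool" where
  "smooth_on U f \<longleftrightarrow> (\<forall>k. Ck_on k U f)"

text \<open>A chart is a domain together with a map; values of the map outside the domain are irrelevant.\<close>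

type_synonym ('a, 'n) chart = "'a set \<times> ('a \<Rightarrow> real ^ 'n)"

abbreviation chart_dom :: "('a, 'n) chart \<Rightarrow> 'a set" where
  "chart_dom \<equiv> fst"

abbreviation chart_map :: "('a, 'n) chart \<Rightarrow> 'a \<Rightarrow> real ^ 'n" where
  "chart_map \<equiv> snd"

definition chart_inv :: "('a, 'n) chart \<Rightarrow> real ^ 'n \<Rightarrow> 'a" where
  "chart_inv c = inv_into (chart_dom c) (chart_map c)"

definition is_chart :: "('a::metric_space, 'n::finite) chart \<Rightarrow> bool" where
  "is_chart c \<longleftrightarrow> open (chart_dom c) \<and> open (chart_map c ` chart_dom c) \<and>
     homeomorphism (chart_dom c) (chart_map c ` chart_dom c) (chart_map c) (chart_inv c)"

definition overlap :: "('a, 'n) chart \<Rightarrow> ('a, 'n) chart \<Rightarrow> (real ^ 'n) set" where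
  "overlap c c' = chart_map c ` (chart_dom c \<inter> chart_dom c')"

definition transition :: "('a, 'n) chart \<Rightarrow> ('a, 'n) chart \<Rightarrow> real ^ 'n \<Rightarrow> real ^ 'n" where
  "transition c c' = chart_map c' \<circ> chart_inv c"

definition smoothly_compatible :: "('a, 'n::finite) chart \<Rightarrow> ('a, 'n) chart \<Rightarrow> bool" where
  "smoothly_compatible c c' \<longleftrightarrow>
     smooth_on (overlap c c') (transition c c') \<and> smooth_on (overlap c' c) (transition c' c)"

text \<open>Atlases are taken to be maximal.\<close>

definition smooth_structure :: "('a::metric_space, 'n::finite) chart set \<Rightarrow> bool" where
  "smooth_structure A \<longleftrightarrow>
     (\<forall>c\<in>A. is_chart c) \<and>
     (\<Union>c\<in>A. chart_dom c) = UNIV \<and>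
     (\<forall>c\<in>A. \<forall>c'\<in>A. smoothly_compatible c c') \<and>
     (\<forall>c. is_chart c \<and> (\<forall>c'\<in>A. smoothly_compatible c c') \<longrightarrow> c \<in> A)"

definition chart_at :: "('a, 'n) chart set \<Rightarrow> 'a \<Rightarrow> ('a, 'n) chart" where
  "chart_at A p = (SOME c. c \<in> A \<and> p \<in> chart_dom c)"


section \<open>Riemannian metrics\<close>

text \<open>
  A Riemannian metric is given by its coordinate expressions: \<open>g c x\<close> is the inner product on
  \<open>real ^ 'n\<close> which the chart \<open>c\<close> induces at the coordinate point \<open>x\<close>.
\<close>

type_synonym ('a, 'n) metric_tensor =
  "('a, 'n) chart \<Rightarrow> real ^ 'n \<Rightarrow> real ^ 'n \<Rightarrow> real ^ 'n \<Rightarrow> real"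

definition riemannian_metric ::
    "('a::metric_space, 'n::finite) chart set \<Rightarrow> ('a, 'n) metric_tensor \<Rightarrow> bool" where
  "riemannian_metric A g \<longleftrightarrow>
     (\<forall>c\<in>A. \<forall>x\<in>chart_map c ` chart_dom c.
        bilinear (g c x) \<and> (\<forall>v w. g c x v w = g c x w v) \<and> (\<forall>v. v \<noteq> 0 \<longrightarrow> g c x v v > 0)) \<and>
     (\<forall>c\<in>A. \<forall>v w. smooth_on (chart_map c ` chart_dom c) (\<lambda>x. g c x v w)) \<and>
     (\<forall>c\<in>A. \<forall>c'\<in>A. \<forall>x\<in>overlap c c'. \<forall>v w.
        g c x v w =
          g c' (transition c c' x)
            (frechet_derivative (transition c c') (at x) v)
            (frechet_derivative (transition c c') (at x) w))"

text \<open>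
  The curves are \<open>C\<^sup>1\<close> away from a finite set \<open>S\<close>, which may contain the endpoints. The derivative
  need not stay bounded near \<open>S\<close>; the length below is a nonnegative Lebesgue integral and may be
  infinite.
\<close>

definition piecewise_C1_curve ::
    "('a::metric_space, 'n::finite) chart set \<Rightarrow> (real \<Rightarrow> 'a) \<Rightarrow> bool" where
  "piecewise_C1_curve A \<gamma> \<longleftrightarrow> continuous_on {0..1} \<gamma> \<and>
     (\<exists>S. finite S \<and> {0, 1} \<subseteq> S \<and>
       (\<forall>c\<in>A. (chart_map c \<circ> \<gamma>) C1_differentiable_on {t \<in> {0..1} - S. \<gamma> t \<in> chart_dom c}))"

definition speed ::
    "('a, 'n::finite) chart set \<Rightarrow> ('a, 'n) metric_tensor \<Rightarrow> (real \<Rightarrow> 'a) \<Rightarrow> real \<Rightarrow> real" where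
  "speed A g \<gamma> t =
     (let c = chart_at A (\<gamma> t); v = vector_derivative (chart_map c \<circ> \<gamma>) (at t)
      in sqrt (g c (chart_map c (\<gamma> t)) v v))"

definition curve_length ::
    "('a, 'n::finite) chart set \<Rightarrow> ('a, 'n) metric_tensor \<Rightarrow> (real \<Rightarrow> 'a) \<Rightarrow> ennreal" where
  "curve_length A g \<gamma> = (\<integral>\<^sup>+t\<in>{0..1}. ennreal (speed A g \<gamma> t) \<partial>lborel)"

definition riemannian_distance ::
    "('a::metric_space, 'n::finite) chart set \<Rightarrow> ('a, 'n) metric_tensor \<Rightarrow> 'a \<Rightarrow> 'a \<Rightarrow> ennreal" where
  "riemannian_distance A g x y =
     (INF \<gamma> \<in> {\<gamma>. piecewise_C1_curve A \<gamma> \<and> \<gamma> 0 = x \<and> \<gamma> 1 = y}. curve_length A g \<gamma>)"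

definition riemannian_manifold ::
    "('a::metric_space, 'n::finite) chart set \<Rightarrow> ('a, 'n) metric_tensor \<Rightarrow> bool" where
  "riemannian_manifold A g \<longleftrightarrow> smooth_structure A \<and> riemannian_metric A g \<and>
     (\<forall>x y. ennreal (dist x y) = riemannian_distance A g x y)"


subsection \<open>Curvature\<close>

text \<open>
  In a chart, with \<open>G = g c\<close>, vectors of \<open>real ^ 'n\<close> are regarded as constant vector fields, so that
  the Levi-Civita connection is \<open>\<nabla>\<^sub>v w = \<Gamma>(v, w)\<close>, given by the Koszul formula.
\<close>

definition dmetric ::
    "(real ^ 'n \<Rightarrow> real ^ 'n \<Rightarrow> real ^ 'n \<Rightarrow> real) \<Rightarrow> real ^ 'n::finite \<Rightarrow>
     real ^ 'n \<Rightarrow> real ^ 'n \<Rightarrow> real ^ 'n \<Rightarrow> real" where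
  "dmetric G x u v w = frechet_derivative (\<lambda>y. G y v w) (at x) u"

definition christoffel ::
    "(real ^ 'n \<Rightarrow> real ^ 'n \<Rightarrow> real ^ 'n \<Rightarrow> real) \<Rightarrow> real ^ 'n::finite \<Rightarrow>
     real ^ 'n \<Rightarrow> real ^ 'n \<Rightarrow> real ^ 'n" where
  "christoffel G x v w =
     (THE z. \<forall>u. G x z u = (dmetric G x v w u + dmetric G x w v u - dmetric G x u v w) / 2)"

text \<open>\<open>R(u, v) w = \<nabla>\<^sub>u \<nabla>\<^sub>v w - \<nabla>\<^sub>v \<nabla>\<^sub>u w\<close>; the bracket term vanishes for constant fields.\<close>

definition curvature ::
    "(real ^ 'n \<Rightarrow> real ^ 'n \<Rightarrow> real ^ 'n \<Rightarrow> real) \<Rightarrow> real ^ 'n::finite \<Rightarrow>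
     real ^ 'n \<Rightarrow> real ^ 'n \<Rightarrow> real ^ 'n \<Rightarrow> real ^ 'n" where
  "curvature G x u v w =
     frechet_derivative (\<lambda>y. christoffel G y v w) (at x) u
     - frechet_derivative (\<lambda>y. christoffel G y u w) (at x) v
     + christoffel G x u (christoffel G x v w)
     - christoffel G x v (christoffel G x u w)"

definition sectional_curvature ::
    "(real ^ 'n \<Rightarrow> real ^ 'n \<Rightarrow> real ^ 'n \<Rightarrow> real) \<Rightarrow> real ^ 'n::finite \<Rightarrow>
     real ^ 'n \<Rightarrow> real ^ 'n \<Rightarrow> real" where
  "sectional_curvature G x u v =
     G x (curvature G x u v v) u / (G x u u * G x v v - (G x u v)\<^sup>2)"

definition bounded_sectional_curvature ::
    "('a, 'n::finite) chart set \<Rightarrow> ('a, 'n) metric_tensor \<Rightarrow> bool" where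
  "bounded_sectional_curvature A g \<longleftrightarrow>
     (\<exists>\<kappa>. \<forall>c\<in>A. \<forall>x\<in>chart_map c ` chart_dom c. \<forall>u v. u \<noteq> v \<and> independent {u, v} \<longrightarrow>
        \<bar>sectional_curvature (g c) x u v\<bar> \<le> \<kappa>)"


subsection \<open>Exponential map and injectivity radius\<close>

definition is_geodesic ::
    "('a::metric_space, 'n::finite) chart set \<Rightarrow> ('a, 'n) metric_tensor \<Rightarrow> (real \<Rightarrow> 'a) \<Rightarrow> bool" where
  "is_geodesic A g \<gamma> \<longleftrightarrow> continuous_on UNIV \<gamma> \<and>
     (\<forall>c\<in>A. \<forall>t. \<gamma> t \<in> chart_dom c \<longrightarrow>
       (let x = chart_map c \<circ> \<gamma>; x' = (\<lambda>s. vector_derivative x (at s)) in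
          x differentiable (at t) \<and>
          (x' has_vector_derivative - christoffel (g c) (x t) (x' t) (x' t)) (at t)))"

text \<open>
  Tangent vectors at \<open>p\<close> are represented in the chart \<open>chart_at A p\<close>. On a complete manifold geodesics
  are defined on the whole line, hence the exponential map is total.
\<close>

definition riem_exp ::
    "('a::metric_space, 'n::finite) chart set \<Rightarrow> ('a, 'n) metric_tensor \<Rightarrow> 'a \<Rightarrow> real ^ 'n \<Rightarrow> 'a" where
  "riem_exp A g p v =
     (THE q. \<exists>\<gamma>. is_geodesic A g \<gamma> \<and> \<gamma> 0 = p \<and>
        vector_derivative (chart_map (chart_at A p) \<circ> \<gamma>) (at 0) = v \<and> \<gamma> 1 = q)"

definition tangent_ball ::
    "('a, 'n::finite) chart set \<Rightarrow> ('a, 'n) metric_tensor \<Rightarrow> 'a \<Rightarrow> real \<Rightarrow> (real ^ 'n) set" where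
  "tangent_ball A g p r =
     (let c = chart_at A p in {v. sqrt (g c (chart_map c p) v v) < r})"

definition exp_diffeomorphic_on_ball ::
    "('a::metric_space, 'n::finite) chart set \<Rightarrow> ('a, 'n) metric_tensor \<Rightarrow> 'a \<Rightarrow> real \<Rightarrow> bool" where
  "exp_diffeomorphic_on_ball A g p r \<longleftrightarrow>
     (let V = tangent_ball A g p r; E = riem_exp A g p in
        open (E ` V) \<and> homeomorphism V (E ` V) E (inv_into V E) \<and>
        (\<forall>c\<in>A. smooth_on (V \<inter> E -` chart_dom c) (chart_map c \<circ> E) \<and>
           smooth_on (chart_map c ` (E ` V \<inter> chart_dom c)) (inv_into V E \<circ> chart_inv c)))"

definition injectivity_radius ::
    "('a::metric_space, 'n::finite) chart set \<Rightarrow> ('a, 'n) metric_tensor \<Rightarrow> 'a \<Rightarrow> ennreal" where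
  "injectivity_radius A g p = (SUP r \<in> {r. r > 0 \<and> exp_diffeomorphic_on_ball A g p r}. ennreal r)"

definition bounded_geometry_manifold ::
    "('a::metric_space, 'n::finite) chart set \<Rightarrow> ('a, 'n) metric_tensor \<Rightarrow> bool" where
  "bounded_geometry_manifold A g \<longleftrightarrow>
     riemannian_manifold A g \<and> connected (UNIV :: 'a set) \<and> complete (UNIV :: 'a set) \<and>
     bounded_sectional_curvature A g \<and>
     (\<exists>\<iota>>0. \<forall>p. ennreal \<iota> \<le> injectivity_radius A g p)"


subsection \<open>Volume and isoperimetric dimension\<close>

definition volume_density ::
    "(real ^ 'n \<Rightarrow> real ^ 'n \<Rightarrow> real ^ 'n \<Rightarrow> real) \<Rightarrow> real ^ 'n::finite \<Rightarrow> real" where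
  "volume_density G x = sqrt (det (\<chi> i j. G x (axis i 1) (axis j 1)))"

definition riemannian_volume ::
    "('a::metric_space, 'n::finite) chart set \<Rightarrow> ('a, 'n) metric_tensor \<Rightarrow> 'a measure" where
  "riemannian_volume A g =
     (THE \<mu>. space \<mu> = UNIV \<and> sets \<mu> = sets borel \<and>
        (\<forall>c\<in>A. \<forall>B\<in>sets borel. B \<subseteq> chart_dom c \<longrightarrow>
           emeasure \<mu> B = (\<integral>\<^sup>+x\<in>chart_map c ` B. ennreal (volume_density (g c) x) \<partial>lborel)))"

text \<open>
  A compact domain with smooth boundary is, near each boundary point, a half space in a suitable
  chart of the maximal atlas. The whole of a compact manifold is allowed.
\<close>

definition smooth_domain :: "('a::metric_space, 'n::finite) chart set \<Rightarrow> 'a set \<Rightarrow> bool" where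
  "smooth_domain A D \<longleftrightarrow> compact D \<and>
     (\<forall>p\<in>frontier D. \<exists>c\<in>A. \<exists>k. p \<in> chart_dom c \<and>
        chart_map c ` (D \<inter> chart_dom c) = {x \<in> chart_map c ` chart_dom c. x $ k \<le> 0})"

text \<open>
  The Riemannian measure of a hypersurface \<open>S\<close> is computed in charts where \<open>S\<close> is the coordinate
  hyperplane \<open>x $ k = 0\<close>, parametrised by the coordinates other than \<open>k\<close>. The density is the square
  root of the Gram determinant of the vectors \<open>axis i 1\<close> with \<open>i \<noteq> k\<close>, i.e. of a principal minor.
  In dimension one this is the counting measure.
\<close>

definition hyperplane_point :: "'n \<Rightarrow> ('n \<Rightarrow> real) \<Rightarrow> real ^ 'n" where
  "hyperplane_point k y = (\<chi> i. if i = k then 0 else y i)"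

definition hyperplane_density ::
    "(real ^ 'n \<Rightarrow> real ^ 'n \<Rightarrow> real ^ 'n \<Rightarrow> real) \<Rightarrow> 'n \<Rightarrow> real ^ 'n::finite \<Rightarrow> real" where
  "hyperplane_density G k x =
     sqrt (det (\<chi> i j. if i = k \<or> j = k then (if i = j then 1 else 0)
                       else G x (axis i 1) (axis j 1)))"

definition hypersurface_area ::
    "('a::metric_space, 'n::finite) chart set \<Rightarrow> ('a, 'n) metric_tensor \<Rightarrow> 'a set \<Rightarrow> 'a measure" where
  "hypersurface_area A g S =
     (THE \<sigma>. space \<sigma> = UNIV \<and> sets \<sigma> = sets borel \<and> emeasure \<sigma> (- S) = 0 \<and>
        (\<forall>c\<in>A. \<forall>k. chart_map c ` (S \<inter> chart_dom c) = {x \<in> chart_map c ` chart_dom c. x $ k = 0} \<longrightarrow>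
           (\<forall>B\<in>sets borel. B \<subseteq> S \<inter> chart_dom c \<longrightarrow>
              emeasure \<sigma> B =
                (\<integral>\<^sup>+y\<in>{y. hyperplane_point k y \<in> chart_map c ` B}.
                   ennreal (hyperplane_density (g c) k (hyperplane_point k y))
                   \<partial>(\<Pi>\<^sub>M i\<in>- {k}. lborel)))))"

definition manifold_isoperimetric_dim_ge ::
    "('a::metric_space, 'n::finite) chart set \<Rightarrow> ('a, 'n) metric_tensor \<Rightarrow> real \<Rightarrow> bool" where
  "manifold_isoperimetric_dim_ge A g d \<longleftrightarrow>
     (\<exists>C V. \<forall>D. smooth_domain A D \<and> measure (riemannian_volume A g) D \<ge> V \<longrightarrow>
        measure (riemannian_volume A g) D \<le>
          C * measure (hypersurface_area A g (frontier D)) (frontier D) powr (d / (d - 1)))"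

definition manifold_isoperimetric_dim_gt_1 ::
    "('a::metric_space, 'n::finite) chart set \<Rightarrow> ('a, 'n) metric_tensor \<Rightarrow> bool" where
  "manifold_isoperimetric_dim_gt_1 A g \<longleftrightarrow> (\<exists>d>1. manifold_isoperimetric_dim_ge A g d)"


section \<open>Polyhedra\<close>

text \<open>
  A polyhedron is the geometric realization of an abstract simplicial complex \<open>K\<close> on vertices of
  type \<open>'v\<close>; \<open>\<beta>\<close> assigns to a point its barycentric coordinates. Simplices are isometric to the
  standard simplex, the convex hull of an orthonormal family.
\<close>

definition abstract_complex :: "'v set set \<Rightarrow> bool" where
  "abstract_complex K \<longleftrightarrow>
     (\<forall>\<sigma>\<in>K. finite \<sigma> \<and> \<sigma> \<noteq> {} \<and> (\<forall>\<tau>. \<tau> \<subseteq> \<sigma> \<and> \<tau> \<noteq> {} \<longrightarrow> \<tau> \<in> K))"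

definition supp :: "('v \<Rightarrow> real) \<Rightarrow> 'v set" where
  "supp x = {v. x v \<noteq> 0}"

definition realization :: "'v set set \<Rightarrow> ('v \<Rightarrow> real) set" where
  "realization K = {x. supp x \<in> K \<and> (\<forall>v. x v \<ge> 0) \<and> (\<Sum>v\<in>supp x. x v) = 1}"

definition simplex_dist :: "('v \<Rightarrow> real) \<Rightarrow> ('v \<Rightarrow> real) \<Rightarrow> real" where
  "simplex_dist x y = sqrt (\<Sum>v\<in>supp x \<union> supp y. (x v - y v)\<^sup>2)"

text \<open>
  The length metric is the infimum of the lengths of broken lines whose successive vertices lie in a
  common simplex; it is infinite if there is no such line.
\<close>

definition broken_line :: "'v set set \<Rightarrow> ('v \<Rightarrow> real) list \<Rightarrow> bool" where
  "broken_line K xs \<longleftrightarrow> xs \<noteq> [] \<and> set xs \<subseteq> realization K \<and>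
     (\<forall>i. Suc i < length xs \<longrightarrow> supp (xs ! i) \<union> supp (xs ! Suc i) \<in> K)"

definition broken_line_length :: "('v \<Rightarrow> real) list \<Rightarrow> real" where
  "broken_line_length xs = (\<Sum>i<length xs - 1. simplex_dist (xs ! i) (xs ! Suc i))"

definition polyhedron_distance ::
    "'v set set \<Rightarrow> ('v \<Rightarrow> real) \<Rightarrow> ('v \<Rightarrow> real) \<Rightarrow> ennreal" where
  "polyhedron_distance K x y =
     (INF xs \<in> {xs. broken_line K xs \<and> hd xs = x \<and> last xs = y}. ennreal (broken_line_length xs))"

definition simplicial_polyhedron ::
    "'v set set \<Rightarrow> ('a::metric_space \<Rightarrow> 'v \<Rightarrow> real) \<Rightarrow> bool" where
  "simplicial_polyhedron K \<beta> \<longleftrightarrow> abstract_complex K \<and> bij_betw \<beta> UNIV (realization K) \<and>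
     (\<forall>x y. ennreal (dist x y) = polyhedron_distance K (\<beta> x) (\<beta> y))"

definition bounded_geometry_polyhedron ::
    "'v set set \<Rightarrow> ('a::metric_space \<Rightarrow> 'v \<Rightarrow> real) \<Rightarrow> bool" where
  "bounded_geometry_polyhedron K \<beta> \<longleftrightarrow>
     simplicial_polyhedron K \<beta> \<and> connected (UNIV :: 'a set) \<and>
     (\<exists>N. \<forall>v\<in>\<Union>K. finite {\<sigma>\<in>K. v \<in> \<sigma>} \<and> card {\<sigma>\<in>K. v \<in> \<sigma>} \<le> N)"

definition boundary_edges :: "'v set set \<Rightarrow> 'v set \<Rightarrow> 'v set set" where
  "boundary_edges K D = {e\<in>K. \<exists>u w. e = {u, w} \<and> u \<in> D \<and> w \<notin> D}"

definition polyhedron_isoperimetric_dim_ge :: "'v set set \<Rightarrow> real \<Rightarrow> bool" where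
  "polyhedron_isoperimetric_dim_ge K d \<longleftrightarrow>
     (\<exists>C V. \<forall>D. finite D \<and> D \<subseteq> \<Union>K \<and> real (card D) \<ge> V \<longrightarrow>
        real (card D) \<le> C * real (card (boundary_edges K D)) powr (d / (d - 1)))"

definition polyhedron_isoperimetric_dim_gt_1 :: "'v set set \<Rightarrow> bool" where
  "polyhedron_isoperimetric_dim_gt_1 K \<longleftrightarrow> (\<exists>d>1. polyhedron_isoperimetric_dim_ge K d)"


section \<open>Packings and coarsely conformal maps\<close>

text \<open>Balls are pairs of a centre and a radius.\<close>

definition balls_between :: "ereal \<Rightarrow> ereal \<Rightarrow> ('a::metric_space \<times> real) set" where
  "balls_between R S = {(x, r). 0 \<le> r \<and> R \<le> ereal r \<and> ereal r \<le> S}"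

definition ball_points :: "'a::metric_space \<times> real \<Rightarrow> 'a set" where
  "ball_points B = cball (fst B) (snd B)"

definition scale_ball :: "real \<Rightarrow> 'a::metric_space \<times> real \<Rightarrow> 'a \<times> real" where
  "scale_ball l B = (fst B, l * snd B)"

definition packing ::
    "real \<Rightarrow> ereal \<Rightarrow> ereal \<Rightarrow> 'i set \<Rightarrow> ('i \<Rightarrow> 'a::metric_space \<times> real) \<Rightarrow> bool" where
  "packing l R S J B \<longleftrightarrow> (\<forall>j\<in>J. B j \<in> balls_between R S) \<and>
     (\<forall>i\<in>J. \<forall>j\<in>J. i \<noteq> j \<longrightarrow>
        ball_points (scale_ball l (B i)) \<inter> ball_points (scale_ball l (B j)) = {})"

definition multi_packing ::
    "nat \<Rightarrow> real \<Rightarrow> ereal \<Rightarrow> ereal \<Rightarrow> 'i set \<Rightarrow> ('i \<Rightarrow> 'a::metric_space \<times> real) \<Rightarrow> bool" where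
  "multi_packing N l R S J B \<longleftrightarrow>
     (\<exists>P :: nat \<Rightarrow> 'i set. J = (\<Union>k<N. P k) \<and> (\<forall>k<N. packing l R S (P k) B))"

text \<open>
  The balls of a packing are pairwise distinct, as a ball contains its centre. Hence a packing of the
  source may be indexed by its own set \<open>J\<close> of balls. Its image is the family indexed by \<open>J\<close>, in which
  repetitions do count.
\<close>

definition coarsely_conformal ::
    "ereal \<Rightarrow> ereal \<Rightarrow> ereal \<Rightarrow> ereal \<Rightarrow> ('a::metric_space \<Rightarrow> 'b::metric_space) \<Rightarrow> bool" where
  "coarsely_conformal R S R' S' f \<longleftrightarrow>
     (\<exists>\<Phi> :: 'a \<times> real \<Rightarrow> 'b \<times> real.
        (\<forall>B\<in>balls_between R S. \<Phi> B \<in> balls_between R' S') \<and>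
        (\<forall>B\<in>balls_between R S. f ` ball_points B \<subseteq> ball_points (\<Phi> B)) \<and>
        (\<forall>l'\<ge>1. \<exists>l\<ge>1. \<exists>N'. \<forall>J.
           packing l R S J (\<lambda>B. B) \<longrightarrow> multi_packing N' l' R' S' J \<Phi>))"

definition large_scale_conformal :: "('a::metric_space \<Rightarrow> 'b::metric_space) \<Rightarrow> bool" where
  "large_scale_conformal f \<longleftrightarrow>
     (\<forall>R'::real. R' > 0 \<longrightarrow> (\<exists>R::real. R > 0 \<and> coarsely_conformal (ereal R) \<infinity> (ereal R') \<infinity> f))"

definition quasi_isometry :: "('a::metric_space \<Rightarrow> 'b::metric_space) \<Rightarrow> bool" where
  "quasi_isometry f \<longleftrightarrow>
     (\<exists>L\<ge>1. \<exists>C\<ge>0.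
        (\<forall>x y. dist x y / L - C \<le> dist (f x) (f y) \<and> dist (f x) (f y) \<le> L * dist x y + C) \<and>
        (\<forall>z. \<exists>x. dist (f x) z \<le> C))"

end

theory Submission
  imports Defs
begin

text \<open>
  The proof rests on one packing argument. If \<open>T\<close> is connected and lies in a unit ball around \<open>x\<close>, but
  \<open>f ` T\<close> has large diameter, then \<open>f ` T\<close> contains the centres of many balls with disjoint dilates.
  The coarsely conformal inverse \<open>h\<close> sends each of them to a ball of radius at least \<open>2\<close> meeting \<open>T\<close>,
  whose double contains \<open>x\<close>; so only boundedly many of them form packings. Hence \<open>f\<close> is bounded on
  connected subsets of unit balls, and cutting an almost shortest path into pieces of unit size
  makes \<open>f\<close> coarsely Lipschitz. The argument is symmetric in \<open>f\<close> and \<open>h\<close>.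
\<close>

section \<open>Coarse Lipschitz estimates\<close>

lemma connected_diameter_bound:
  fixes f :: "'a::metric_space \<Rightarrow> 'b::metric_space" and h :: "'b \<Rightarrow> 'a"
  assumes cont: "continuous_on UNIV f" and inv: "\<And>x. h (f x) = x"
    and conf: "large_scale_conformal h"
  obtains M where "\<And>T x y. connected T \<Longrightarrow> x \<in> T \<Longrightarrow> y \<in> T \<Longrightarrow> T \<subseteq> cball x 1 \<Longrightarrow> dist (f x) (f y) \<le> M"
proof -
  \<comment> \<open>The image balls \<open>\<Phi> B\<close> have radius r \<ge> 2. If such a ball
    contains a point within 1 of \<open>x\<close>, its double contains \<open>x\<close>, since r + 1
    \<le> 2 r.\<close>
  obtain R where R: "R > 0" and "coarsely_conformal (ereal R) \<infinity> (ereal 2) \<infinity> h"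
    using conf unfolding large_scale_conformal_def by (meson zero_less_numeral)
  then obtain \<Phi> where
      \<Phi>1: "\<forall>B\<in>balls_between (ereal R) \<infinity>. \<Phi> B \<in> balls_between (ereal 2) \<infinity>"
      and \<Phi>2: "\<forall>B\<in>balls_between (ereal R) \<infinity>. h ` ball_points B \<subseteq> ball_points (\<Phi> B)"
      and pack: "\<forall>l'\<ge>1. \<exists>l\<ge>1. \<exists>N'. \<forall>J. packing l (ereal R) \<infinity> J (\<lambda>B. B) \<longrightarrow>
        multi_packing N' l' (ereal 2) \<infinity> J \<Phi>"
    unfolding coarsely_conformal_def by (elim exE conjE) (rule that)
  obtain l N where l: "l \<ge> 1"
    and N: "\<And>J. packing l (ereal R) \<infinity> J (\<lambda>B. B) \<Longrightarrow> multi_packing N 2 (ereal 2) \<infinity> J \<Phi>"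
    using pack[rule_format, of 2] by auto
  \<comment> \<open>A larger distance leaves room for \<open>N + 1\<close> points of
    \<open>T\<close> at image distances 0, 3 l R, ..., 3 l R N from \<open>f x\<close>, one more
    than the number \<open>N\<close> of packings.\<close>
  have bound: "dist (f x) (f y) \<le> 3 * l * R * N"
    if T: "connected T" "x \<in> T" "y \<in> T" "T \<subseteq> cball x 1" for T x y
  proof (rule ccontr)
    assume far: "\<not> ?thesis"
    have "connected ((\<lambda>p. dist (f x) (f p)) ` T)"
      by (intro connected_continuous_image T continuous_intros continuous_on_subset[OF cont]) auto
    moreover have "0 \<in> (\<lambda>p. dist (f x) (f p)) ` T" "dist (f x) (f y) \<in> (\<lambda>p. dist (f x) (f p)) ` T"
      using T by (auto intro: rev_image_eqI)
    ultimately have ivt: "{0..dist (f x) (f y)} \<subseteq> (\<lambda>p. dist (f x) (f p)) ` T"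
      by (rule connected_contains_Icc)
    have "\<exists>p\<in>T. dist (f x) (f p) = 3 * l * R * i" if "i \<le> N" for i :: nat
    proof -
      have "3 * l * R * i \<le> 3 * l * R * N" "0 \<le> 3 * l * R * i"
        using that l R by (auto intro!: mult_left_mono mult_nonneg_nonneg)
      then have "3 * l * R * i \<in> {0..dist (f x) (f y)}"
        using far unfolding atLeastAtMost_iff by linarith
      then show ?thesis
        using ivt by fastforce
    qed
    then obtain p where p: "\<And>i. i \<le> N \<Longrightarrow> p i \<in> T" "\<And>i. i \<le> N \<Longrightarrow> dist (f x) (f (p i)) = 3 * l * R * i"
      by metis
    define B where "B i = (f (p i), R)" for i
    have apart: "dist (f (p i)) (f (p j)) \<ge> 3 * l * R" if "i \<le> N" "j \<le> N" "i \<noteq> j" for i j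
    proof -
      have "\<bar>real i - real j\<bar> \<ge> 1"
        using that by linarith
      then have "3 * l * R * 1 \<le> 3 * l * R * \<bar>real i - real j\<bar>"
        using l R by (intro mult_left_mono) auto
      also have "\<dots> = \<bar>3 * l * R * (real i - real j)\<bar>"
        using l R by (simp add: abs_mult)
      also have "\<dots> = \<bar>dist (f x) (f (p i)) - dist (f x) (f (p j))\<bar>"
        using p that by (simp add: algebra_simps)
      also have "\<dots> \<le> dist (f (p i)) (f (p j))"
        by (metis abs_dist_diff_le dist_commute)
      finally show ?thesis by simp
    qed
    \<comment> \<open>A packing of the source is indexed by its own set of balls, so the pigeonhole
      argument below needs different indices to give different balls.\<close>
    have inj: "inj_on B {..N}"
    proof (rule inj_onI, rule ccontr)
      fix i j assume "i \<in> {..N}" "j \<in> {..N}" "B i = B j" "i \<noteq> j"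
      with apart[of i j] have "3 * l * R \<le> 0"
        by (simp add: B_def)
      with l R show False
        by (simp add: mult_le_0_iff)
    qed
    have disj: "cball (f (p i)) (l * R) \<inter> cball (f (p j)) (l * R) = {}" if "i \<le> N" "j \<le> N" "i \<noteq> j" for i j
    proof -
      \<comment> \<open>The spacing \<open>3 * l * R\<close> exceeds the sum of the two dilated
        radii.\<close>
      have "l * R + l * R < 3 * l * R" using l R by simp
      also have "\<dots> \<le> dist (f (p i)) (f (p j))" using apart[OF that] .
      finally show ?thesis by (rule disjoint_cballI)
    qed
    have "packing l (ereal R) \<infinity> (B ` {..N}) (\<lambda>B. B)"
      using R disj by (auto simp: packing_def B_def balls_between_def ball_points_def scale_ball_def)
    then obtain P where P: "B ` {..N} = (\<Union>k<N. P k)" "\<And>k. k < N \<Longrightarrow> packing 2 (ereal 2) \<infinity> (P k) \<Phi>"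
      using N unfolding multi_packing_def by blast
    have centre: "x \<in> ball_points (scale_ball 2 (\<Phi> (B i)))" if "i \<le> N" for i
    proof -
      have Bi: "B i \<in> balls_between (ereal R) \<infinity>"
        using R by (auto simp: B_def balls_between_def)
      have "f (p i) \<in> ball_points (B i)"
        using R by (simp add: B_def ball_points_def)
      then have "p i \<in> ball_points (\<Phi> (B i))"
        using \<Phi>2[rule_format, OF Bi] inv[of "p i"] by (metis image_subset_iff)
      moreover have "snd (\<Phi> (B i)) \<ge> 2"
        using \<Phi>1[rule_format, OF Bi] by (auto simp: balls_between_def)
      moreover have "dist x (p i) \<le> 1"
        using p(1)[OF that] T(4) by auto
      ultimately show ?thesis
        using dist_triangle[of "fst (\<Phi> (B i))" x "p i"]
        by (simp add: ball_points_def scale_ball_def dist_commute)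
    qed
    have "\<forall>i\<le>N. \<exists>k<N. B i \<in> P k"
      using P(1) by auto
    then obtain k where k: "\<And>i. i \<le> N \<Longrightarrow> k i < N" "\<And>i. i \<le> N \<Longrightarrow> B i \<in> P (k i)"
      by metis
    \<comment> \<open>Pigeonhole: two of the \<open>N + 1\<close> balls fall into the same packing,
      where the doubled image balls are disjoint, yet both doubles contain \<open>x\<close>.\<close>
    have "card (k ` {..N}) \<le> card {..<N}"
      using k by (intro card_mono) auto
    then have "\<not> inj_on k {..N}"
      by (auto dest: card_image)
    then obtain i j where ij: "i \<le> N" "j \<le> N" "i \<noteq> j" "k i = k j"
      by (auto simp: inj_on_def)
    have "B i \<noteq> B j"
      using inj_onD[OF inj, of i j] ij by auto
    moreover have "B i \<in> P (k i)" "B j \<in> P (k i)"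
      using k(2)[of i] k(2)[of j] ij by auto
    ultimately have "ball_points (scale_ball 2 (\<Phi> (B i))) \<inter> ball_points (scale_ball 2 (\<Phi> (B j))) = {}"
      using P(2)[OF k(1)[OF ij(1)]] unfolding packing_def by blast
    then show False
      using centre ij by blast
  qed
  show ?thesis
    by (rule that[OF bound])
qed

section \<open>Cutting paths into pieces of unit size\<close>

text \<open>Induction on \<open>n\<close>. The arc up to the first time at distance 1 from its start
  stays in a unit ball, so \<open>f\<close> moves its ends at most \<open>M\<close> apart, and it
  uses up at least 1 of the increment of \<open>\<phi>\<close>. The added 1 accounts for the last
  piece.\<close>

lemma path_cutting_bound:
  fixes f :: "'a::metric_space \<Rightarrow> 'b::metric_space" and \<gamma> :: "real \<Rightarrow> 'a"
  assumes M: "\<And>T x y. connected T \<Longrightarrow> x \<in> T \<Longrightarrow> y \<in> T \<Longrightarrow> T \<subseteq> cball x 1 \<Longrightarrow> dist (f x) (f y) \<le> M"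
    and "a \<le> b" and "continuous_on {a..b} \<gamma>"
    and "\<And>s t. a \<le> s \<Longrightarrow> s \<le> t \<Longrightarrow> t \<le> b \<Longrightarrow> dist (\<gamma> s) (\<gamma> t) \<le> \<phi> t - \<phi> s"
    and "\<phi> b - \<phi> a \<le> real n"
  shows "dist (f (\<gamma> a)) (f (\<gamma> b)) \<le> M * (real n + 1)"
  using assms(2-)
proof (induction n arbitrary: a)
  case (0 a)
  \<comment> \<open>No increment of \<open>\<phi>\<close> is left, so the distances from
    \<open>\<gamma> t\<close> to both ends of the path add up to at most 0.\<close>
  have "dist (\<gamma> a) (\<gamma> t) \<le> 1" if "t \<in> {a..b}" for t
    using 0(3)[of a t] 0(3)[of t b] 0(4) that zero_le_dist[of "\<gamma> t" "\<gamma> b"]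
    by (simp del: zero_le_dist)
  then have "dist (f (\<gamma> a)) (f (\<gamma> b)) \<le> M"
    using 0 by (intro M[of "\<gamma> ` {a..b}"] connected_continuous_image) auto
  then show ?case by simp
next
  case (Suc n a)
  have M0: "M \<ge> 0"
    using M[of "{\<gamma> a}" "\<gamma> a" "\<gamma> a"] by simp
  have cont: "continuous_on {a..c} (\<lambda>t. dist (\<gamma> a) (\<gamma> t))" if "c \<le> b" for c
    using that by (intro continuous_intros continuous_on_subset[OF Suc.prems(2)]) auto
  show ?case
  proof (cases "\<forall>t\<in>{a..b}. dist (\<gamma> a) (\<gamma> t) \<le> 1")
    case True
    then have "dist (f (\<gamma> a)) (f (\<gamma> b)) \<le> M"
      using Suc.prems by (intro M[of "\<gamma> ` {a..b}"] connected_continuous_image) auto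
    also have "\<dots> \<le> M * (real (Suc n) + 1)"
      using M0 by (simp add: mult_le_cancel_left1 algebra_simps)
    finally show ?thesis .
  next
    case False
    have ivt: "\<exists>s\<in>{a..t}. dist (\<gamma> a) (\<gamma> s) = 1" if "t \<in> {a..b}" "dist (\<gamma> a) (\<gamma> t) > 1" for t
      using IVT'[of "\<lambda>t. dist (\<gamma> a) (\<gamma> t)" a 1 t] cont[of t] that by auto
    \<comment> \<open>The times at distance exactly 1 form a compact set; its least element is the
      cutting time.\<close>
    let ?S = "{t \<in> {a..b}. dist (\<gamma> a) (\<gamma> t) = 1}"
    have "?S = {a..b} \<inter> (\<lambda>t. dist (\<gamma> a) (\<gamma> t)) -` {1}"
      by auto
    then have "compact ?S"
      using continuous_closed_preimage[OF cont, of b "{1}"] by (simp add: compact_eq_bounded_closed bounded_Int)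
    moreover have "?S \<noteq> {}"
      using False ivt by fastforce
    ultimately obtain s where s: "s \<in> ?S" "\<And>t. t \<in> ?S \<Longrightarrow> s \<le> t"
      by (meson compact_attains_inf)
    \<comment> \<open>If the path were farther than 1 away at some time up to \<open>s\<close>, the
      intermediate value theorem would give an element of \<open>?S\<close> below
      \<open>s\<close>.\<close>
    have "dist (\<gamma> a) (\<gamma> t) \<le> 1" if t: "t \<in> {a..s}" for t
    proof (rule ccontr)
      assume *: "\<not> ?thesis"
      then obtain r where "r \<in> {a..t}" "dist (\<gamma> a) (\<gamma> r) = 1"
        using ivt[of t] t s by auto
      with s(1) s(2)[of r] t * show False by (cases "r = t") auto
    qed
    then have "dist (f (\<gamma> a)) (f (\<gamma> s)) \<le> M"
      using Suc.prems s
      by (intro M[of "\<gamma> ` {a..s}"] connected_continuous_image) (auto intro: continuous_on_subset)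
    moreover have "dist (f (\<gamma> s)) (f (\<gamma> b)) \<le> M * (real n + 1)"
    proof (rule Suc.IH)
      show "continuous_on {s..b} \<gamma>"
        using s by (intro continuous_on_subset[OF Suc.prems(2)]) auto
      \<comment> \<open>The increment \<open>\<phi> s - \<phi> a\<close> dominates
        \<open>dist (\<gamma> a) (\<gamma> s) = 1\<close>, so the remaining budget drops from
        \<open>Suc n\<close> to \<open>n\<close>.\<close>
      show "\<phi> b - \<phi> s \<le> real n"
        using Suc.prems(3)[of a s] Suc.prems(4) s by auto
    qed (use s Suc.prems in auto)
    ultimately show ?thesis
      using dist_triangle[of "f (\<gamma> a)" "f (\<gamma> b)" "f (\<gamma> s)"] by (simp add: algebra_simps)
  qed
qed

text \<open>\<open>\<phi>\<close> plays the role of arc length along an almost shortest path.\<close>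

definition length_controlled :: "'a::metric_space itself \<Rightarrow> bool" where
  "length_controlled TYPE('a) \<longleftrightarrow> (\<forall>x y :: 'a. \<exists>\<gamma> \<phi>. \<exists>a b :: real. a \<le> b \<and> continuous_on {a..b} \<gamma> \<and>
     \<gamma> a = x \<and> \<gamma> b = y \<and> (\<forall>s t. a \<le> s \<and> s \<le> t \<and> t \<le> b \<longrightarrow> dist (\<gamma> s) (\<gamma> t) \<le> \<phi> t - \<phi> s) \<and>
     \<phi> b - \<phi> a \<le> dist x y + 1)"

text \<open>Of the additive constant \<open>3 * M\<close>, one \<open>M\<close> comes from the slack
  1 of an almost shortest path, one from rounding up to \<open>n\<close>, and one from the last
  piece in \<open>path_cutting_bound\<close>.\<close>

lemma coarse_Lipschitz:
  fixes f :: "'a::metric_space \<Rightarrow> 'b::metric_space" and h :: "'b \<Rightarrow> 'a"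
  assumes X: "length_controlled TYPE('a)" and cont: "continuous_on UNIV f"
    and inv: "\<And>x. h (f x) = x" and conf: "large_scale_conformal h"
  obtains M where "M \<ge> 0" "\<And>x y. dist (f x) (f y) \<le> M * dist x y + 3 * M"
proof -
  obtain M where M: "\<And>T x y. connected T \<Longrightarrow> x \<in> T \<Longrightarrow> y \<in> T \<Longrightarrow> T \<subseteq> cball x 1 \<Longrightarrow> dist (f x) (f y) \<le> M"
    using connected_diameter_bound[OF cont inv conf] by blast
  have "M \<ge> 0"
    using M[of "{undefined}" undefined undefined] by simp
  moreover have "dist (f x) (f y) \<le> M * dist x y + 3 * M" for x y
  proof -
    obtain \<gamma> \<phi> and a b :: real where \<gamma>: "a \<le> b \<and> continuous_on {a..b} \<gamma> \<and> \<gamma> a = x \<and> \<gamma> b = y \<and>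
        (\<forall>s t. a \<le> s \<and> s \<le> t \<and> t \<le> b \<longrightarrow> dist (\<gamma> s) (\<gamma> t) \<le> \<phi> t - \<phi> s) \<and>
        \<phi> b - \<phi> a \<le> dist x y + 1"
      using X[unfolded length_controlled_def, THEN spec, THEN spec, of x y] by (elim exE) (rule that)
    define n where "n = nat \<lceil>dist x y + 1\<rceil>"
    have n: "dist x y + 1 \<le> real n" "real n \<le> dist x y + 2"
      using zero_le_dist[of x y] unfolding n_def by linarith+
    have "dist (f (\<gamma> a)) (f (\<gamma> b)) \<le> M * (real n + 1)"
      by (rule path_cutting_bound[where \<phi> = \<phi>, OF M]) (use \<gamma> n in auto)
    also have "\<dots> \<le> M * (dist x y + 3)"
      using n \<open>M \<ge> 0\<close> by (intro mult_left_mono) auto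
    finally show ?thesis
      using \<gamma> by (simp add: algebra_simps)
  qed
  ultimately show ?thesis
    using that by blast
qed

section \<open>Riemannian manifolds\<close>

text \<open>Measurability of the speed of a curve is not available, hence the lower integral estimates below.\<close>

lemma nn_integral_superadd:
  "integral\<^sup>N M f + integral\<^sup>N M g \<le> (\<integral>\<^sup>+x. f x + g x \<partial>M)"
proof -
  let ?I = "\<lambda>f. {u. simple_function M u \<and> u \<le> f}"
  have ne: "?I f \<noteq> {}" for f :: "'a \<Rightarrow> ennreal"
  proof -
    have "(\<lambda>_. 0) \<in> ?I f" by (simp add: le_fun_def)
    then show ?thesis by blast
  qed
  \<comment> \<open>Simple functions are measurable, so their integrals add; suprema over both
    nonempty families then give the claim for arbitrary \<open>f\<close> and
    \<open>g\<close>.\<close>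
  have "integral\<^sup>S M u + integral\<^sup>S M v \<le> (\<integral>\<^sup>+x. f x + g x \<partial>M)" if "u \<in> ?I f" "v \<in> ?I g" for u v
  proof -
    have "integral\<^sup>S M u + integral\<^sup>S M v = (\<integral>\<^sup>+x. u x + v x \<partial>M)"
      using that by (simp add: nn_integral_eq_simple_integral[symmetric] nn_integral_add
          borel_measurable_simple_function)
    also have "\<dots> \<le> (\<integral>\<^sup>+x. f x + g x \<partial>M)"
      using that by (intro nn_integral_mono add_mono) (auto simp: le_fun_def)
    finally show ?thesis .
  qed
  then have "(SUP u\<in>?I f. SUP v\<in>?I g. integral\<^sup>S M u + integral\<^sup>S M v) \<le> (\<integral>\<^sup>+x. f x + g x \<partial>M)"
    by (intro SUP_least)
  then show ?thesis
    by (simp only: nn_integral_def[of M f] nn_integral_def[of M g]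
        ennreal_SUP_add_left[OF ne] ennreal_SUP_add_right[OF ne, symmetric])
qed

text \<open>The change of variables is applied only to the simple functions below the left
  integrand. Pulled back along the inverse affine map and divided by \<open>c\<close>, each of them
  lies below \<open>H\<close>.\<close>

lemma nn_integral_affine_le:
  fixes c :: real
  assumes c: "c > 0"
  shows "(\<integral>\<^sup>+u. ennreal c * H (s + c * u) \<partial>lborel) \<le> integral\<^sup>N lborel H"
  unfolding nn_integral_def[of lborel "\<lambda>u. ennreal c * H (s + c * u)"]
proof (rule SUP_least, clarsimp)
  fix u assume u: "simple_function lborel u" "u \<le> (\<lambda>u. ennreal c * H (s + c * u))"
  have [measurable]: "u \<in> borel_measurable borel"
    using borel_measurable_simple_function[OF u(1)] by simp
  have "integral\<^sup>S lborel u = (\<integral>\<^sup>+x. u x \<partial>lborel)"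
    using u by (simp add: nn_integral_eq_simple_integral)
  also have "\<dots> = (\<integral>\<^sup>+x. ennreal (1/c) * u (- s / c + (1/c) * x) \<partial>lborel)"
    using c by (subst nn_integral_real_affine[of u "1/c" "- s / c"]) (auto simp: nn_integral_cmult)
  also have "\<dots> \<le> integral\<^sup>N lborel H"
  proof (rule nn_integral_mono)
    fix x
    have "ennreal (1/c) * u (- s / c + (1/c) * x) \<le> ennreal (1/c) * (ennreal c * H (s + c * (- s / c + (1/c) * x)))"
      using u(2) by (intro mult_left_mono) (auto simp: le_fun_def)
    also have "\<dots> = (ennreal (1/c) * ennreal c) * H x"
      using c by (simp add: mult.assoc field_simps)
    also have "\<dots> = H x"
      using c by (simp add: ennreal_mult[symmetric])
    finally show "ennreal (1/c) * u (- s / c + (1/c) * x) \<le> H x" .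
  qed
  finally show "integral\<^sup>S lborel u \<le> integral\<^sup>N lborel H" .
qed

section \<open>Affine reparametrisation of curves\<close>

lemma chart_at:
  assumes "smooth_structure A"
  shows "chart_at A p \<in> A" "p \<in> chart_dom (chart_at A p)"
proof -
  have "\<exists>c. c \<in> A \<and> p \<in> chart_dom c"
    using assms unfolding smooth_structure_def by blast
  from someI_ex[OF this] show "chart_at A p \<in> A" "p \<in> chart_dom (chart_at A p)"
    unfolding chart_at_def by auto
qed

lemma piecewise_C1_curve_affine:
  assumes \<gamma>: "piecewise_C1_curve A \<gamma>" and st: "0 \<le> s" "s < t" "t \<le> 1"
  shows "piecewise_C1_curve A (\<lambda>u. \<gamma> (s + (t - s) * u))"
proof -
  let ?a = "\<lambda>u. s + (t - s) * u"
  have range: "?a u \<in> {0..1}" if "u \<in> {0..1}" for u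
  proof -
    have "0 \<le> (t - s) * u" "(t - s) * u \<le> t - s"
      using that st by (auto simp: mult_left_le)
    with st show ?thesis unfolding atLeastAtMost_iff by linarith
  qed
  obtain S where S: "finite S" "{0, 1} \<subseteq> S"
    and C1: "\<And>c. c \<in> A \<Longrightarrow> (chart_map c \<circ> \<gamma>) C1_differentiable_on {t \<in> {0..1} - S. \<gamma> t \<in> chart_dom c}"
    and cont: "continuous_on {0..1} \<gamma>"
    using \<gamma> unfolding piecewise_C1_curve_def by blast
  have inj: "inj ?a"
    using st by (auto simp: inj_def)
  have "continuous_on {0..1} (\<lambda>u. \<gamma> (?a u))"
    by (rule continuous_on_compose2[OF cont]) (use range in \<open>auto intro!: continuous_intros\<close>)
  \<comment> \<open>The exceptional set consists of the old exceptional times, pulled back along the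
    injective affine map, and of the new endpoints.\<close>
  moreover have "finite (?a -` S \<union> {0, 1})"
    using finite_vimageI[OF S(1) inj] by simp
  moreover have "(chart_map c \<circ> (\<lambda>u. \<gamma> (?a u))) C1_differentiable_on
      {u \<in> {0..1} - (?a -` S \<union> {0, 1}). \<gamma> (?a u) \<in> chart_dom c}" (is "_ C1_differentiable_on ?U")
    if "c \<in> A" for c
  proof -
    have "((chart_map c \<circ> \<gamma>) \<circ> ?a) C1_differentiable_on ?U"
    proof (rule C1_differentiable_compose)
      show "?a C1_differentiable_on ?U"
        by (auto simp: C1_differentiable_on_def intro!: exI[of _ "\<lambda>_. t - s"] derivative_eq_intros)
      show "chart_map c \<circ> \<gamma> C1_differentiable_on ?a ` ?U"
        by (rule C1_differentiable_on_subset[OF C1[OF that]]) (use range in auto)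
      show "finite (?U \<inter> ?a -` {x})" for x
        using finite_vimageI[of "{x}", OF _ inj] by simp
    qed
    then show ?thesis by (simp add: o_def)
  qed
  ultimately show ?thesis
    unfolding piecewise_C1_curve_def by (intro conjI exI[of _ "?a -` S \<union> {0, 1}"]) auto
qed

text \<open>Off finitely many times the chain rule multiplies the speed by \<open>t - s\<close>,
  which the substitution \<open>nn_integral_affine_le\<close> absorbs. This direction bounds the
  distance of two points of a curve by the length of the arc between them.\<close>

lemma curve_length_affine_le:
  assumes A: "smooth_structure A" "riemannian_metric A g"
    and \<gamma>: "piecewise_C1_curve A \<gamma>" and st: "0 \<le> s" "s < t" "t \<le> 1"
  shows "curve_length A g (\<lambda>u. \<gamma> (s + (t - s) * u)) \<le> (\<integral>\<^sup>+u\<in>{s..t}. ennreal (speed A g \<gamma> u) \<partial>lborel)"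
proof -
  let ?a = "\<lambda>u. s + (t - s) * u"
  let ?H = "\<lambda>u. ennreal (speed A g \<gamma> u) * indicator {s..t} u"
  obtain S where S: "finite S" 
    and C1: "\<And>c. c \<in> A \<Longrightarrow> (chart_map c \<circ> \<gamma>) C1_differentiable_on {t \<in> {0..1} - S. \<gamma> t \<in> chart_dom c}"
    using \<gamma> unfolding piecewise_C1_curve_def by blast
  have inj: "inj ?a"
    using st by (auto simp: inj_def)
  have mem: "?a u \<in> {s..t} \<longleftrightarrow> u \<in> {0..1}" for u
  proof -
    have "s + (t - s) * u \<le> t \<longleftrightarrow> (t - s) * u \<le> (t - s) * 1" by auto
    also have "\<dots> \<longleftrightarrow> u \<le> 1" using st by (intro mult_le_cancel_left_pos) simp
    finally show ?thesis using st by (auto simp: zero_le_mult_iff)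
  qed
  \<comment> \<open>\<open>chart_at\<close> depends on the point alone, so both speeds are computed
    in the same chart.\<close>
  have speed: "speed A g (\<lambda>u. \<gamma> (?a u)) u = (t - s) * speed A g \<gamma> (?a u)" if u: "u \<in> {0..1}" "?a u \<notin> S" for u
  proof -
    define c where "c = chart_at A (\<gamma> (?a u))"
    have c: "c \<in> A" "\<gamma> (?a u) \<in> chart_dom c"
      using chart_at[OF A(1)] by (auto simp: c_def)
    have "?a u \<in> {0..1}"
      using mem[of u] u st by auto
    then obtain v where v: "(chart_map c \<circ> \<gamma> has_vector_derivative v) (at (?a u))"
      using C1[OF c(1)] c u unfolding C1_differentiable_on_def by auto
    have "((chart_map c \<circ> \<gamma>) \<circ> ?a has_vector_derivative (t - s) *\<^sub>R v) (at u)"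
      by (rule vector_diff_chain_at) (use v in \<open>auto intro!: derivative_eq_intros\<close>)
    then have "vector_derivative (chart_map c \<circ> (\<lambda>u. \<gamma> (?a u))) (at u) = (t - s) *\<^sub>R v"
      by (simp add: o_def vector_derivative_at)
    moreover have "vector_derivative (chart_map c \<circ> \<gamma>) (at (?a u)) = v"
      using v by (simp add: vector_derivative_at)
    moreover have "bilinear (g c (chart_map c (\<gamma> (?a u))))"
      using A(2) c unfolding riemannian_metric_def by blast
    then have "g c (chart_map c (\<gamma> (?a u))) ((t - s) *\<^sub>R v) ((t - s) *\<^sub>R v) =
        (t - s)\<^sup>2 * g c (chart_map c (\<gamma> (?a u))) v v"
      by (simp add: bilinear_lmul bilinear_rmul power2_eq_square)
    ultimately show ?thesis
      using st by (simp add: speed_def c_def[symmetric] real_sqrt_mult)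
  qed
  have "AE u in lborel. u \<notin> ?a -` S"
    using finite_imp_null_set_lborel[OF finite_vimageI[OF S inj]] by (rule AE_not_in)
  then have "AE u in lborel. ennreal (speed A g (\<lambda>u. \<gamma> (?a u)) u) * indicator {0..1} u
      = ennreal (t - s) * ?H (?a u)"
  proof eventually_elim
    case (elim u)
    show ?case
    proof (cases "u \<in> {0..1}")
      case True
      with mem[of u] elim st show ?thesis
        by (simp add: speed ennreal_mult')
    next
      case False
      then have "?a u \<notin> {s..t}" using mem by blast
      with False show ?thesis by (simp only: indicator_simps mult_zero_right not_False_eq_True)
    qed
  qed
  then have "curve_length A g (\<lambda>u. \<gamma> (?a u)) = (\<integral>\<^sup>+u. ennreal (t - s) * ?H (?a u) \<partial>lborel)"
    unfolding curve_length_def by (rule nn_integral_cong_AE)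
  also have "\<dots> \<le> integral\<^sup>N lborel ?H"
    using st by (intro nn_integral_affine_le) simp
  finally show ?thesis .
qed

text \<open>\<open>\<phi> t\<close> is the length of the initial arc of an almost minimising curve.
  The distance of two points of the curve is at most the length of the arc between them, and
  superadditivity of the lower integral bounds that by the increment of
  \<open>\<phi>\<close>.\<close>

lemma riemannian_length_controlled:
  fixes A :: "('a::metric_space, 'm::finite) chart set"
  assumes "riemannian_manifold A g"
  shows "length_controlled TYPE('a)"
  unfolding length_controlled_def
proof (intro allI)
  fix x y :: 'a
  have A: "smooth_structure A" "riemannian_metric A g"
    and dist: "\<And>x y. ennreal (dist x y) = riemannian_distance A g x y"
    using assms unfolding riemannian_manifold_def by auto
  have "riemannian_distance A g x y < ennreal (dist x y + 1)"
    by (simp add: dist[symmetric] ennreal_less_iff)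
  then obtain \<gamma> where \<gamma>: "piecewise_C1_curve A \<gamma>" "\<gamma> 0 = x" "\<gamma> 1 = y"
    and len: "curve_length A g \<gamma> < ennreal (dist x y + 1)"
    unfolding riemannian_distance_def by (auto simp: INF_less_iff)
  define F where "F S = (\<integral>\<^sup>+u\<in>S. ennreal (speed A g \<gamma> u) \<partial>lborel)" for S
  have mono: "F S \<le> F T" if "S \<subseteq> T" for S T
    unfolding F_def using that by (intro nn_integral_mono) (auto simp: indicator_def)
  have F1: "F {0..1} = curve_length A g \<gamma>"
    by (simp add: F_def curve_length_def)
  have fin: "F {0..t} < top" if "t \<le> 1" for t
    using mono[of "{0..t}" "{0..1}"] len that
    by (metis F1 atLeastatMost_subset_iff ennreal_less_top le_less_trans less_trans order_refl)
  have super: "F {0..s} + F {s..t} \<le> F {0..t}" if "0 \<le> s" "s \<le> t" for s t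
  proof -
    \<comment> \<open>Removing the null set \<open>{s}\<close> makes the two intervals
      disjoint.\<close>
    have "AE u in lborel. u \<notin> {s}"
      by (intro AE_not_in finite_imp_null_set_lborel) simp
    then have "F {s..t} = F {s<..t}"
      unfolding F_def by (intro nn_integral_cong_AE) (auto elim!: eventually_mono simp: indicator_def)
    then have "F {0..s} + F {s..t} \<le> (\<integral>\<^sup>+u. ennreal (speed A g \<gamma> u) * indicator {0..s} u
        + ennreal (speed A g \<gamma> u) * indicator {s<..t} u \<partial>lborel)"
      unfolding F_def using nn_integral_superadd by simp
    also have "\<dots> \<le> F {0..t}"
      unfolding F_def using that by (intro nn_integral_mono) (auto simp: indicator_def)
    finally show ?thesis .
  qed
  define \<phi> where "\<phi> t = enn2real (F {0..t})" for t
  have \<phi>: "ennreal (\<phi> t) = F {0..t}" if "t \<le> 1" for t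
    using fin[OF that] by (simp add: \<phi>_def)
  have "dist (\<gamma> s) (\<gamma> t) \<le> \<phi> t - \<phi> s" if st: "0 \<le> s" "s \<le> t" "t \<le> 1" for s t
  proof (cases "s = t")
    case False
    let ?\<delta> = "\<lambda>u. \<gamma> (s + (t - s) * u)"
    have "ennreal (dist (\<gamma> s) (\<gamma> t)) \<le> curve_length A g ?\<delta>"
      unfolding dist riemannian_distance_def
      using piecewise_C1_curve_affine[OF \<gamma>(1), of s t] st False by (intro INF_lower) auto
    also have "\<dots> \<le> F {s..t}"
      unfolding F_def using st False by (intro curve_length_affine_le[OF A \<gamma>(1)]) auto
    finally have "ennreal (\<phi> s) + ennreal (dist (\<gamma> s) (\<gamma> t)) \<le> ennreal (\<phi> t)"
      using super[of s t] st \<phi> by (metis add_left_mono order_trans)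
    then have "\<phi> s + dist (\<gamma> s) (\<gamma> t) \<le> \<phi> t"
      by (simp add: \<phi>_def ennreal_plus[symmetric] del: ennreal_plus)
    then show ?thesis by simp
  qed simp
  moreover have "\<phi> 1 - \<phi> 0 \<le> dist x y + 1"
  proof -
    have "ennreal (\<phi> 1) \<le> ennreal (dist x y + 1)"
      using len \<phi>[of 1] F1 by simp
    then have "\<phi> 1 \<le> dist x y + 1"
      by (subst (asm) ennreal_le_iff) (auto intro: add_nonneg_nonneg)
    moreover have "\<phi> 0 \<ge> 0" by (simp add: \<phi>_def)
    ultimately show ?thesis by simp
  qed
  moreover have "continuous_on {0..1} \<gamma>"
    using \<gamma> by (simp add: piecewise_C1_curve_def)
  ultimately show "\<exists>\<gamma> \<phi>. \<exists>a b :: real. a \<le> b \<and> continuous_on {a..b} \<gamma> \<and> \<gamma> a = x \<and> \<gamma> b = y \<and>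
     (\<forall>s t. a \<le> s \<and> s \<le> t \<and> t \<le> b \<longrightarrow> dist (\<gamma> s) (\<gamma> t) \<le> \<phi> t - \<phi> s) \<and> \<phi> b - \<phi> a \<le> dist x y + 1"
    using \<gamma> by (intro exI[of _ \<gamma>] exI[of _ \<phi>] exI[of _ 0] exI[of _ 1]) auto
qed

section \<open>Polyhedra\<close>

lemma supp_convex_subset: "supp (\<lambda>v. (1 - t) * x v + t * y v) \<subseteq> supp x \<union> supp y"
  by (auto simp: supp_def)

lemma segment_in_realization:
  assumes K: "abstract_complex K" and xy: "x \<in> realization K" "y \<in> realization K" "supp x \<union> supp y \<in> K"
    and t: "0 \<le> t" "t \<le> 1"
  shows "(\<lambda>v. (1 - t) * x v + t * y v) \<in> realization K" (is "?z \<in> _")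
proof -
  let ?U = "supp x \<union> supp y"
  have fin: "finite ?U"
    using K xy(3) unfolding abstract_complex_def by blast
  have one: "sum w ?U = 1" if "w = x \<or> w = y" for w
  proof -
    have "sum w ?U = sum w (supp w)"
      using fin that by (intro sum.mono_neutral_right) (auto simp: supp_def)
    with that xy show ?thesis by (auto simp: realization_def)
  qed
  have "sum ?z (supp ?z) = sum ?z ?U"
    using fin supp_convex_subset[of t x y] by (intro sum.mono_neutral_left) (auto simp: supp_def)
  also have "\<dots> = (1 - t) * sum x ?U + t * sum y ?U"
    by (simp add: sum.distrib sum_distrib_left)
  finally have sum: "sum ?z (supp ?z) = 1"
    by (simp add: one)
  \<comment> \<open>The support may be a proper face of the common simplex; as the coordinates sum
    to 1 it is nonempty, hence belongs to \<open>K\<close>.\<close>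
  then have "supp ?z \<noteq> {}" by auto
  then have "supp ?z \<in> K"
    using K xy(3) supp_convex_subset[of t x y] unfolding abstract_complex_def by blast
  with sum xy t show ?thesis
    by (auto simp: realization_def)
qed

text \<open>Coordinates outside both supports contribute zero. Distances between different points of
  one simplex can thus be summed over the same index set.\<close>

lemma simplex_dist_superset:
  assumes "finite U" "supp x \<union> supp y \<subseteq> U"
  shows "simplex_dist x y = sqrt (\<Sum>v\<in>U. (x v - y v)\<^sup>2)"
proof -
  have "(\<Sum>v\<in>supp x \<union> supp y. (x v - y v)\<^sup>2) = (\<Sum>v\<in>U. (x v - y v)\<^sup>2)"
    using assms by (intro sum.mono_neutral_left) (auto simp: supp_def)
  then show ?thesis by (simp add: simplex_dist_def)
qed

lemma simplex_dist_segment: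
  assumes "finite (supp x \<union> supp y)"
  shows "simplex_dist (\<lambda>v. (1 - s) * x v + s * y v) (\<lambda>v. (1 - t) * x v + t * y v) = \<bar>t - s\<bar> * simplex_dist x y"
proof -
  let ?U = "supp x \<union> supp y"
  have "((1 - s) * x v + s * y v - ((1 - t) * x v + t * y v))\<^sup>2 = (t - s)\<^sup>2 * (x v - y v)\<^sup>2" for v
    by (simp add: power2_eq_square algebra_simps)
  then have "(\<Sum>v\<in>?U. ((1 - s) * x v + s * y v - ((1 - t) * x v + t * y v))\<^sup>2)
      = (t - s)\<^sup>2 * (\<Sum>v\<in>?U. (x v - y v)\<^sup>2)"
    by (simp add: sum_distrib_left)
  then show ?thesis
    using assms supp_convex_subset[of s x y] supp_convex_subset[of t x y]
    by (subst simplex_dist_superset[of ?U]) (auto simp: real_sqrt_mult simplex_dist_def)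
qed

text \<open>The line with the single edge from \<open>\<beta> p\<close> to \<open>\<beta> q\<close>
  competes in the infimum.\<close>

lemma dist_le_simplex_dist:
  assumes P: "simplicial_polyhedron K \<beta>" and xy: "\<beta> p \<in> realization K" "\<beta> q \<in> realization K" "supp (\<beta> p) \<union> supp (\<beta> q) \<in> K"
  shows "dist p q \<le> simplex_dist (\<beta> p) (\<beta> q)"
proof -
  have "ennreal (dist p q) \<le> ennreal (broken_line_length [\<beta> p, \<beta> q])"
    using P xy unfolding simplicial_polyhedron_def polyhedron_distance_def
    by (auto intro!: INF_lower simp: broken_line_def less_Suc_eq)
  moreover have "broken_line_length [\<beta> p, \<beta> q] = simplex_dist (\<beta> p) (\<beta> q)"
    by (simp add: broken_line_length_def)
  moreover have "simplex_dist (\<beta> p) (\<beta> q) \<ge> 0"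
    by (simp add: simplex_dist_def sum_nonneg)
  ultimately show ?thesis by simp
qed

section \<open>Arc length parametrisation of broken lines\<close>

lemma segment_path:
  fixes \<beta> :: "'a::metric_space \<Rightarrow> 'v \<Rightarrow> real"
  assumes P: "simplicial_polyhedron K \<beta>"
    and xy: "\<beta> p \<in> realization K" "\<beta> q \<in> realization K" "supp (\<beta> p) \<union> supp (\<beta> q) \<in> K"
  obtains \<gamma> where "\<gamma> 0 = p" "\<gamma> (simplex_dist (\<beta> p) (\<beta> q)) = q"
    "\<And>s t. 0 \<le> s \<Longrightarrow> s \<le> t \<Longrightarrow> t \<le> simplex_dist (\<beta> p) (\<beta> q) \<Longrightarrow> dist (\<gamma> s) (\<gamma> t) \<le> t - s"
proof -
  let ?L = "simplex_dist (\<beta> p) (\<beta> q)"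
  define z where "z t = (\<lambda>v. (1 - t) * \<beta> p v + t * \<beta> q v)" for t
  have K: "abstract_complex K" and bij: "bij_betw \<beta> UNIV (realization K)"
    using P by (auto simp: simplicial_polyhedron_def)
  have fin: "finite (supp (\<beta> p) \<union> supp (\<beta> q))"
    using K xy(3) unfolding abstract_complex_def by blast
  have real: "z t \<in> realization K" if "0 \<le> t" "t \<le> 1" for t
    unfolding z_def using segment_in_realization[OF K xy that] .
  have \<beta>inv: "\<beta> (inv \<beta> w) = w" if "w \<in> realization K" for w
    using bij that by (simp add: bij_betw_def f_inv_into_f)
  have inj: "inv \<beta> (\<beta> w) = w" for w
    using bij by (simp add: bij_betw_def inv_f_f)
  show ?thesis
  \<comment> \<open>The parameter of the segment is time divided by \<open>?L\<close>, so a
    degenerate segment is treated as a constant path.\<close>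
  proof (cases "?L = 0")
    case True
    then have "p = q"
      using dist_le_simplex_dist[OF P xy] by simp
    with True show ?thesis by (intro that[of "\<lambda>_. p"]) auto
  next
    case False
    then have L: "?L > 0"
      by (simp add: simplex_dist_def sum_nonneg order_less_le)
    have "dist (inv \<beta> (z (s / ?L))) (inv \<beta> (z (t / ?L))) \<le> t - s" if st: "0 \<le> s" "s \<le> t" "t \<le> ?L" for s t
    proof -
      have r: "z (s / ?L) \<in> realization K" "z (t / ?L) \<in> realization K"
        using st L by (auto intro!: real)
      have "supp (z (s / ?L)) \<union> supp (z (t / ?L)) \<subseteq> supp (\<beta> p) \<union> supp (\<beta> q)"
        unfolding z_def by (intro Un_least supp_convex_subset)
      moreover have "supp (z (s / ?L)) \<noteq> {}"
        using r(1) by (auto simp: realization_def)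
      ultimately have "supp (z (s / ?L)) \<union> supp (z (t / ?L)) \<in> K"
        using K xy(3) unfolding abstract_complex_def by blast
      then have "dist (inv \<beta> (z (s / ?L))) (inv \<beta> (z (t / ?L))) \<le> simplex_dist (z (s / ?L)) (z (t / ?L))"
        using dist_le_simplex_dist[OF P, of "inv \<beta> (z (s / ?L))" "inv \<beta> (z (t / ?L))"] r by (simp add: \<beta>inv)
      also have "\<dots> = \<bar>t / ?L - s / ?L\<bar> * ?L"
        unfolding z_def by (rule simplex_dist_segment[OF fin])
      also have "\<dots> = t - s"
        using st L by (simp add: diff_divide_distrib[symmetric])
      finally show ?thesis .
    qed
    moreover have "z 0 = \<beta> p" "z 1 = \<beta> q"
      by (auto simp: z_def)
    ultimately show ?thesis
      using L inj by (intro that[of "\<lambda>t. inv \<beta> (z (t / ?L))"]) auto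
  qed
qed

text \<open>The edges are parametrised by \<open>segment_path\<close> and concatenated; for times on
  both sides of a junction the triangle inequality through \<open>q\<close> gives the bound.\<close>

lemma broken_line_path:
  fixes \<beta> :: "'a::metric_space \<Rightarrow> 'v \<Rightarrow> real"
  assumes P: "simplicial_polyhedron K \<beta>" and "ps \<noteq> []" "broken_line K (map \<beta> ps)"
  shows "\<exists>\<gamma>. \<gamma> 0 = hd ps \<and> \<gamma> (broken_line_length (map \<beta> ps)) = last ps \<and>
    (\<forall>s t. 0 \<le> s \<and> s \<le> t \<and> t \<le> broken_line_length (map \<beta> ps) \<longrightarrow> dist (\<gamma> s) (\<gamma> t) \<le> t - s)"
  using assms(2-)
proof (induction ps rule: induct_list012)
  case 1
  then show ?case by simp
next
  case (2 p)
  then show ?case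
    by (intro exI[of _ "\<lambda>_. p"]) (auto simp: broken_line_length_def)
next
  case (3 p q ps)
  let ?L = "simplex_dist (\<beta> p) (\<beta> q)" and ?L' = "broken_line_length (map \<beta> (q # ps))"
  have len: "broken_line_length (map \<beta> (p # q # ps)) = ?L + ?L'"
    by (simp add: broken_line_length_def sum.lessThan_Suc_shift del: sum.lessThan_Suc)
  have L0: "?L \<ge> 0" "?L' \<ge> 0"
    by (auto simp: broken_line_length_def simplex_dist_def intro!: sum_nonneg)
  have edge: "\<beta> p \<in> realization K" "\<beta> q \<in> realization K" "supp (\<beta> p) \<union> supp (\<beta> q) \<in> K"
    using 3(4) by (auto simp: broken_line_def dest: spec[of _ 0])
  have "broken_line K (map \<beta> (q # ps))"
    using 3(4) unfolding broken_line_def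
    by (metis (no_types, lifting) Suc_less_eq length_Cons list.discI list.simps(9) nth_Cons_Suc
        set_subset_Cons subset_trans)
  then obtain \<gamma>' where \<gamma>': "\<gamma>' 0 = q" "\<gamma>' ?L' = last (q # ps)"
      "\<And>s t. 0 \<le> s \<Longrightarrow> s \<le> t \<Longrightarrow> t \<le> ?L' \<Longrightarrow> dist (\<gamma>' s) (\<gamma>' t) \<le> t - s"
    using 3(2) by auto
  obtain \<gamma> where \<gamma>: "\<gamma> 0 = p" "\<gamma> ?L = q"
      "\<And>s t. 0 \<le> s \<Longrightarrow> s \<le> t \<Longrightarrow> t \<le> ?L \<Longrightarrow> dist (\<gamma> s) (\<gamma> t) \<le> t - s"
    using segment_path[OF P edge] by blast
  define \<delta> where "\<delta> t = (if t \<le> ?L then \<gamma> t else \<gamma>' (t - ?L))" for t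
  have "dist (\<delta> s) (\<delta> t) \<le> t - s" if st: "0 \<le> s" "s \<le> t" "t \<le> ?L + ?L'" for s t
  proof -
    consider "t \<le> ?L" | "s > ?L" | "s \<le> ?L" "?L < t" by linarith
    then show ?thesis
    proof cases
      case 3
      have "dist (\<gamma> s) (\<gamma>' (t - ?L)) \<le> dist (\<gamma> s) (\<gamma> ?L) + dist (\<gamma>' 0) (\<gamma>' (t - ?L))"
        using \<gamma>(2) \<gamma>'(1) by (simp add: dist_triangle)
      with \<gamma>(3)[of s ?L] \<gamma>'(3)[of 0 "t - ?L"] 3 st show ?thesis
        by (simp add: \<delta>_def)
    qed (use st \<gamma>(3)[of s t] \<gamma>'(3)[of "s - ?L" "t - ?L"] in \<open>auto simp: \<delta>_def\<close>)
  qed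
  moreover have "\<delta> 0 = p"
    using \<gamma> L0 by (simp add: \<delta>_def)
  \<comment> \<open>If \<open>?L'\<close> is 0, the end time falls into the first branch of
    \<open>\<delta>\<close>, where \<open>\<gamma> ?L = q = \<gamma>' 0\<close> is the last
    point.\<close>
  moreover have "\<delta> (?L + ?L') = last (q # ps)"
    using \<gamma> \<gamma>' L0 by (cases "?L' = 0") (auto simp: \<delta>_def)
  ultimately show ?case
    unfolding len by (intro exI[of _ \<delta>]) auto
qed

text \<open>An almost shortest broken line gives a path that is 1-Lipschitz, hence continuous, and
  \<open>\<phi>\<close> is the identity.\<close>

lemma polyhedron_length_controlled:
  fixes \<beta> :: "'a::metric_space \<Rightarrow> 'v \<Rightarrow> real"
  assumes P: "simplicial_polyhedron K \<beta>"
  shows "length_controlled TYPE('a)"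
  unfolding length_controlled_def
proof (intro allI)
  fix x y :: 'a
  have bij: "bij_betw \<beta> UNIV (realization K)"
    using P by (auto simp: simplicial_polyhedron_def)
  have "polyhedron_distance K (\<beta> x) (\<beta> y) = ennreal (dist x y)"
    using P by (simp add: simplicial_polyhedron_def)
  also have "\<dots> < ennreal (dist x y + 1)"
    by (simp add: ennreal_less_iff del: ennreal_plus)
  finally have "polyhedron_distance K (\<beta> x) (\<beta> y) < ennreal (dist x y + 1)" .
  then obtain xs where xs: "broken_line K xs" "hd xs = \<beta> x" "last xs = \<beta> y"
    and len: "ennreal (broken_line_length xs) < ennreal (dist x y + 1)"
    unfolding polyhedron_distance_def by (auto simp: INF_less_iff)
  have L0: "broken_line_length xs \<ge> 0"
    by (auto simp: broken_line_length_def simplex_dist_def intro!: sum_nonneg)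
  define ps where "ps = map (inv \<beta>) xs"
  have "xs \<noteq> []" "set xs \<subseteq> realization K"
    using xs(1) by (auto simp: broken_line_def)
  moreover have "\<beta> (inv \<beta> w) = w" if "w \<in> realization K" for w
    using bij that by (simp add: bij_betw_def f_inv_into_f)
  ultimately have ps: "map \<beta> ps = xs" "ps \<noteq> []"
    by (auto simp: ps_def map_idI subset_iff)
  have "hd ps = x" "last ps = y"
    using bij xs \<open>xs \<noteq> []\<close> by (auto simp: ps_def hd_map last_map bij_betw_def inv_f_f)
  then obtain \<gamma> where \<gamma>: "\<gamma> 0 = x" "\<gamma> (broken_line_length xs) = y"
      "\<And>s t. 0 \<le> s \<Longrightarrow> s \<le> t \<Longrightarrow> t \<le> broken_line_length xs \<Longrightarrow> dist (\<gamma> s) (\<gamma> t) \<le> t - s"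
    using broken_line_path[OF P ps(2)] xs(1) ps by auto
  have "1-lipschitz_on {0..broken_line_length xs} \<gamma>"
  proof (rule lipschitz_onI)
    fix s t assume "s \<in> {0..broken_line_length xs}" "t \<in> {0..broken_line_length xs}"
    then show "dist (\<gamma> s) (\<gamma> t) \<le> 1 * dist s t"
      using \<gamma>(3)[of s t] \<gamma>(3)[of t s] by (auto simp: dist_real_def dist_commute abs_if)
  qed simp
  then have "continuous_on {0..broken_line_length xs} \<gamma>"
    by (rule lipschitz_on_continuous_on)
  moreover have "broken_line_length xs \<le> dist x y + 1"
    using len L0 by (simp add: ennreal_less_iff del: ennreal_plus)
  ultimately show "\<exists>\<gamma> \<phi>. \<exists>a b :: real. a \<le> b \<and> continuous_on {a..b} \<gamma> \<and> \<gamma> a = x \<and> \<gamma> b = y \<and>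
     (\<forall>s t. a \<le> s \<and> s \<le> t \<and> t \<le> b \<longrightarrow> dist (\<gamma> s) (\<gamma> t) \<le> \<phi> t - \<phi> s) \<and> \<phi> b - \<phi> a \<le> dist x y + 1"
    using \<gamma> L0
    by (intro exI[of _ \<gamma>] exI[of _ "\<lambda>t. t"] exI[of _ 0] exI[of _ "broken_line_length xs"]) auto
qed

theorem theorem2:
  fixes A :: "('a::metric_space, 'm::finite) chart set" and g :: "('a, 'm) metric_tensor"
    and K :: "'v set set" and \<beta> :: "'a \<Rightarrow> 'v \<Rightarrow> real"
    and A' :: "('b::metric_space, 'n::finite) chart set" and g' :: "('b, 'n) metric_tensor"
    and K' :: "'w set set" and \<beta>' :: "'b \<Rightarrow> 'w \<Rightarrow> real"
    and f :: "'a \<Rightarrow> 'b" and h :: "'b \<Rightarrow> 'a"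
  assumes X: "(bounded_geometry_manifold A g \<and> manifold_isoperimetric_dim_gt_1 A g) \<or>
              (bounded_geometry_polyhedron K \<beta> \<and> polyhedron_isoperimetric_dim_gt_1 K)"
    and X': "(bounded_geometry_manifold A' g' \<and> manifold_isoperimetric_dim_gt_1 A' g') \<or>
             (bounded_geometry_polyhedron K' \<beta>' \<and> polyhedron_isoperimetric_dim_gt_1 K')"
    and homeo: "homeomorphism UNIV UNIV f h"
    and conf: "large_scale_conformal f"
    and conf_inv: "large_scale_conformal h"
  shows "quasi_isometry f"
proof -
  have lc: "length_controlled TYPE('a)" "length_controlled TYPE('b)"
    using X riemannian_length_controlled[of A g] polyhedron_length_controlled[of K \<beta>]
      X' riemannian_length_controlled[of A' g'] polyhedron_length_controlled[of K' \<beta>']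
    by (auto simp: bounded_geometry_manifold_def bounded_geometry_polyhedron_def)
  have cont: "continuous_on UNIV f" "continuous_on UNIV h"
    and inv: "\<And>x. h (f x) = x" "\<And>z. f (h z) = z"
    using homeo by (auto simp: homeomorphism_def)
  \<comment> \<open>The estimate for \<open>f\<close> uses that its inverse \<open>h\<close> is
    large scale conformal; the one for \<open>h\<close> uses this for \<open>f\<close>.\<close>
  obtain M where M: "M \<ge> 0" "\<And>x y. dist (f x) (f y) \<le> M * dist x y + 3 * M"
    using coarse_Lipschitz[OF lc(1) cont(1) inv(1) conf_inv] by blast
  obtain M' where M': "M' \<ge> 0" "\<And>u v. dist (h u) (h v) \<le> M' * dist u v + 3 * M'"
    using coarse_Lipschitz[OF lc(2) cont(2) inv(2) conf] by blast
  define L where "L = 1 + M + M'"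
  have L: "L \<ge> 1" "M \<le> L" "M' \<le> L"
    using M(1) M'(1) by (auto simp: L_def)
  have "dist (f x) (f y) \<le> L * dist x y + 3 * L" for x y
    using M(2)[of x y] L mult_right_mono[of M L "dist x y"] by simp
  \<comment> \<open>The upper estimate for \<open>h\<close> at \<open>f x\<close> and
    \<open>f y\<close>, divided by \<open>L\<close>; from \<open>M' \<le> L\<close> and
    \<open>L \<ge> 1\<close> its constant satisfies 3 M' \<le> L (3 L).\<close>
  moreover have "dist x y / L - 3 * L \<le> dist (f x) (f y)" for x y
  proof -
    have "dist x y \<le> M' * dist (f x) (f y) + 3 * M'"
      using M'(2)[of "f x" "f y"] by (simp add: inv)
    also have "\<dots> \<le> L * dist (f x) (f y) + L * (3 * L)"
      using L mult_right_mono[of M' L "dist (f x) (f y)"] mult_mono[of 1 L M' L] M'(1) by simp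
    finally show ?thesis
      using L by (simp add: field_simps)
  qed
  moreover have "dist (f (h z)) z \<le> 3 * L" for z
    using L by (simp add: inv)
  ultimately show ?thesis
    unfolding quasi_isometry_def using L by (intro exI[of _ L] exI[of _ "3 * L"] conjI) (auto, blast)
qed

end
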